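(* Let $d\ge 1$ and $0\le k\le n$ be integers. Then $$\frac{\{n:d\}!}{\{k:d\}!\,\{n-k:d\}!}=\sum_{P}\operatorname{wt}P,$$ where the sum is over all $d$-divisible partial tilings $P$ associated with lattice paths going from $(kd,0)$ to $(0,n)$ in $\delta_{n:d}$. Consequently the $d$-divisible Lucasnomial $\left\{{n:d\atop k:d}\right\}=\frac{\{n:d\}!}{\{k:d\}!\{n-k:d\}!}$ lies in $\mathbb{N}[s,t]$.
   Context: Let $s,t$ be indeterminates and $\mathbb{N}=\{0,1,2,\dots\}$. The Lucas sequence is $\{0\}=0$, $\{1\}=1$, $\{n\}=s\{n-1\}+t\{n-2\}$ for $n\ge 2$. The $d$-divisible Lucastorial is $\{n:d\}!=\{d\}\{2d\}\cdots\{nd\}$, with $\{0:d\}!=1$. The $d$-divisible staircase $\delta_{n:d}=(nd-1,(n-1)d-1,\dots,2d-1,d-1)$ is drawn in the first quadrant with unit boxes, southwest corner at the origin, the $i$th row from the bottom having $(n-i+1)d-1$ boxes. The unit segment from $(nd-1,0)$ to $(nd,0)$, and the segment of the $y$-axis up to $(0,n)$, are also part of the diagram. A tiling of $\delta_{n:d}$ is a tiling of each row by monominoes (one box) and dominoes (two adjacent boxes of a row). Given a tiling $T$ of $\delta_{n:d}$, its path goes from $(kd,0)$ to $(0,n)$ by unit north and west steps as follows. From a point $(jd,y)$ with $y<n$: if a north step to $(jd,y+1)$ does not cross a domino of $T$ and stays in the diagram, the path takes it, and this north step is called an $NI$ step. Otherwise the path takes one west step to $(jd-1,y)$, then a north step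 to $(jd-1,y+1)$, called an $NL$ step, and then $d-1$ west steps to $((j-1)d,y+1)$. The $d$-divisible partial tiling $P$ associated with $T$ consists of the path together with the tiles of $T$ lying, in the row of each $NI$ step, to the left of that step and, in the row of each $NL$ step, to the right of that step; all other boxes are blank. Different $T$ giving the same path and the same such tiles give the same $d$-divisible partial tiling, counted once. The weight is $\operatorname{wt}P=s^{\#\text{monominoes in }P}\,t^{\#\text{dominoes in }P}$. *)

theory Defs
  imports "HOL-Computational_Algebra.Polynomial_Factorial"
begin

text \<open>
  The ring of integer polynomials in the two indeterminates \<open>s\<close> and \<open>t\<close> is modelled by
  \<^typ>\<open>int poly poly\<close>: the inner variable is \<open>s\<close>, the outer one is \<open>t\<close>. Quotients are taken
  in its field of fractions.
\<close>

definition s_var :: "int poly poly" where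
  "s_var = [:[:0, 1:]:]"

definition t_var :: "int poly poly" where
  "t_var = [:0, 1:]"

definition nat_polys :: "int poly poly set" where
  "nat_polys = {p. \<forall>i j. coeff (coeff p i) j \<in> \<nat>}"

fun lucas :: "nat \<Rightarrow> int poly poly" where
  "lucas 0 = 0"
| "lucas (Suc 0) = 1"
| "lucas (Suc (Suc n)) = s_var * lucas (Suc n) + t_var * lucas n"

definition lucastorial :: "nat \<Rightarrow> nat \<Rightarrow> int poly poly" where
  "lucastorial d n = (\<Prod>i = 1..n. lucas (i * d))"

definition lucasnomial :: "nat \<Rightarrow> nat \<Rightarrow> nat \<Rightarrow> int poly poly fract" where
  "lucasnomial d n k =
     to_fract (lucastorial d n) / (to_fract (lucastorial d k) * to_fract (lucastorial d (n - k)))"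

text \<open>
  The box \<open>(a, y)\<close> is the unit square with southwest corner \<open>(a, y)\<close>; rows are thus numbered
  from \<open>0\<close> at the bottom. With \<open>d \<ge> 1\<close>, \<open>k \<le> n\<close> and in the
  rows \<open>y < n\<close>, no subtraction below truncates.
\<close>

definition row_length :: "nat \<Rightarrow> nat \<Rightarrow> nat \<Rightarrow> nat" where
  "row_length d n y = (n - y) * d - 1"

definition staircase :: "nat \<Rightarrow> nat \<Rightarrow> (nat \<times> nat) set" where
  "staircase d n = {(a, y). y < n \<and> a < row_length d n y}"

text \<open>\<open>Domino a y\<close> covers the boxes \<open>(a, y)\<close> and \<open>(a + 1, y)\<close>.\<close>

datatype tile = Monomino nat nat | Domino nat nat

fun boxes :: "tile \<Rightarrow> (nat \<times> nat) set" where
  "boxes (Monomino a y) = {(a, y)}"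
| "boxes (Domino a y) = {(a, y), (a + 1, y)}"

definition is_tiling :: "nat \<Rightarrow> nat \<Rightarrow> tile set \<Rightarrow> bool" where
  "is_tiling d n T \<longleftrightarrow>
     (\<Union>\<tau>\<in>T. boxes \<tau>) = staircase d n \<and>
     (\<forall>\<tau>\<in>T. \<forall>\<tau>'\<in>T. \<tau> \<noteq> \<tau>' \<longrightarrow> boxes \<tau> \<inter> boxes \<tau>' = {})"

text \<open>
  Steps carry their starting point: \<open>West x y\<close> goes from \<open>(x, y)\<close> to \<open>(x - 1, y)\<close>, while
  \<open>NI x y\<close> and \<open>NL x y\<close> are the two kinds of north steps, from \<open>(x, y)\<close> to \<open>(x, y + 1)\<close>.
  The kind of a north step is determined by the underlying lattice path (for a path built by
  \<open>path_from\<close>), so recording it does not distinguish further paths: if \<open>d \<ge> 2\<close> it is read off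
  from \<open>x\<close> modulo \<open>d\<close>, and if \<open>d = 1\<close> the \<open>NL\<close> steps are those preceded by a west step.
\<close>

datatype step = West nat nat | NI nat nat | NL nat nat

definition crosses_domino :: "tile set \<Rightarrow> nat \<Rightarrow> nat \<Rightarrow> bool" where
  "crosses_domino T x y \<longleftrightarrow> (\<exists>a. x = a + 1 \<and> Domino a y \<in> T)"

text \<open>
  A north step from \<open>(x, y)\<close> stays in the diagram if it lies in the closed region of row \<open>y\<close>;
  for a row without boxes (\<open>d = 1\<close>, \<open>y = n - 1\<close>) this is the segment of the \<open>y\<close>-axis.
\<close>

definition north_in_diagram :: "nat \<Rightarrow> nat \<Rightarrow> nat \<Rightarrow> nat \<Rightarrow> bool" where
  "north_in_diagram d n x y \<longleftrightarrow> y < n \<and> x \<le> row_length d n y"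

text \<open>\<open>path_from d n T j y\<close> is the rest of the path of \<open>T\<close> from the point \<open>(j * d, y)\<close> on.\<close>

function path_from :: "nat \<Rightarrow> nat \<Rightarrow> tile set \<Rightarrow> nat \<Rightarrow> nat \<Rightarrow> step list" where
  "path_from d n T j y =
     (if n \<le> y then []
      else if north_in_diagram d n (j * d) y \<and> \<not> crosses_domino T (j * d) y
      then NI (j * d) y # path_from d n T j (y + 1)
      else West (j * d) y # NL (j * d - 1) y
           # map (\<lambda>i. West (j * d - 1 - i) (y + 1)) [0..<d - 1]
           @ path_from d n T (j - 1) (y + 1))"
  by auto
termination
  by (relation "measure (\<lambda>(d, n, T, j, y). n - y)") auto

declare path_from.simps [simp del]

fun kept_by :: "step \<Rightarrow> tile \<Rightarrow> bool" where
  "kept_by (West x y) \<tau> \<longleftrightarrow> False"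
| "kept_by (NI x y) \<tau> \<longleftrightarrow> (\<forall>(a, b)\<in>boxes \<tau>. b = y \<and> a + 1 \<le> x)"
| "kept_by (NL x y) \<tau> \<longleftrightarrow> (\<forall>(a, b)\<in>boxes \<tau>. b = y \<and> x \<le> a)"

type_synonym partial_tiling = "step list \<times> tile set"

definition partial_tiling_of :: "nat \<Rightarrow> nat \<Rightarrow> nat \<Rightarrow> tile set \<Rightarrow> partial_tiling" where
  "partial_tiling_of d n k T =
     (let p = path_from d n T k 0 in (p, {\<tau> \<in> T. \<exists>\<sigma>\<in>set p. kept_by \<sigma> \<tau>}))"

text \<open>
  A path built by \<open>path_from d n T k 0\<close> with \<open>k \<le> n\<close> necessarily ends at \<open>(0, n)\<close>, as the
  points \<open>(j * d, y)\<close> it visits satisfy \<open>j + y \<le> n\<close>.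
\<close>

definition partial_tilings :: "nat \<Rightarrow> nat \<Rightarrow> nat \<Rightarrow> partial_tiling set" where
  "partial_tilings d n k = partial_tiling_of d n k ` {T. is_tiling d n T}"

definition wt :: "partial_tiling \<Rightarrow> int poly poly" where
  "wt P = s_var ^ card {\<tau> \<in> snd P. \<exists>a y. \<tau> = Monomino a y}
        * t_var ^ card {\<tau> \<in> snd P. \<exists>a y. \<tau> = Domino a y}"

end

theory Submission
  imports Defs
begin

text \<open>
  Both sides satisfy the Lucas analogue of Pascal's recurrence. Consider the partial tilings of the
  \<open>m = n - y\<close> rows above height \<open>y\<close> whose path starts at \<open>(j * d, y)\<close>. The bottom one of these rows
  has \<open>m * d - 1\<close> boxes, and what it contributes depends on its north step only:

  \<^item> If the step is an \<open>NI\<close> step, possible for \<open>j < m\<close>, the kept tiles form an arbitrary tiling of the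
    \<open>j * d\<close> boxes to its left. A row of \<open>l\<close> boxes has tilings of total weight \<open>lucas (l + 1)\<close>, so
    the contribution is \<open>lucas (j * d + 1)\<close>, and the path goes on from \<open>(j * d, y + 1)\<close>.
  \<^item> If the step is an \<open>NL\<close> step, possible for \<open>j > 0\<close>, the kept tiles form a tiling of the
    \<open>(m - j) * d\<close> boxes to the right of \<open>j * d - 1\<close> that starts with the domino which blocked the
    north step. This contributes \<open>t * lucas ((m - j) * d - 1)\<close>. For \<open>j = m\<close> the step was blocked by
    the boundary instead, no box lies to its right, and the contribution is \<open>1\<close>. The path goes on
    from \<open>((j - 1) * d, y + 1)\<close>.

  The choice in the bottom row and the partial tiling of the rows above it are independent, since
  every tiling of the kept part of a row extends to a tiling of the whole row (fill the rest with
  monominoes); this is \<open>partials_Suc\<close>. The weight sum \<open>F m j\<close> therefore satisfies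
  \<open>F m j = lucas (j * d + 1) * F (m - 1) j + t * lucas ((m - j) * d - 1) * F (m - 1) (j - 1)\<close> for
  \<open>0 < j < m\<close>. Because of the addition formula
  \<open>lucas (a + b) = lucas (a + 1) * lucas b + t * lucas a * lucas (b - 1)\<close> with \<open>a = j * d\<close> and
  \<open>b = (m - j) * d\<close>, induction on \<open>m\<close> gives that \<open>F m j\<close> times the lucastorials of \<open>j\<close> and \<open>m - j\<close>
  is the lucastorial of \<open>m\<close>. Lucas polynomials of positive index are nonzero, so one may divide.
  Membership in \<open>\<nat>[s, t]\<close> follows because every weight is a monomial with coefficient \<open>1\<close>.
\<close>

section \<open>Lucas polynomials\<close>

lemma lucas_add:
  "lucas (a + Suc b) = lucas (Suc a) * lucas (Suc b) + t_var * lucas a * lucas b"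
proof (induction a rule: lucas.induct)
  case 1
  show ?case by simp
next
  case 2
  show ?case by (simp add: algebra_simps)
next
  case (3 n)
  have "lucas (Suc (Suc n) + Suc b) = s_var * lucas (Suc n + Suc b) + t_var * lucas (n + Suc b)"
    by simp
  then show ?case
    unfolding 3 by (simp add: algebra_simps)
qed

text \<open>
  At \<open>s = t = 1\<close> the Lucas polynomials become Fibonacci numbers, which are positive. The second
  conjunct is what the induction needs at index \<open>0\<close>.
\<close>

lemma lucas_at_one_pos: "poly (poly (lucas (Suc n)) 1) 1 > 0 \<and> poly (poly (lucas n) 1) 1 \<ge> 0"
  by (induction n) (auto simp: s_var_def t_var_def)

lemma lucas_nonzero: "n > 0 \<Longrightarrow> lucas n \<noteq> 0"
  using lucas_at_one_pos[of "n - 1"] by (cases n) auto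

lemma lucastorial_0 [simp]: "lucastorial d 0 = 1"
  by (simp add: lucastorial_def)

lemma lucastorial_Suc: "lucastorial d (Suc n) = lucas (Suc n * d) * lucastorial d n"
  by (simp add: lucastorial_def mult.commute)

lemma lucastorial_nonzero: "d \<ge> 1 \<Longrightarrow> lucastorial d n \<noteq> 0"
  by (simp add: lucastorial_def lucas_nonzero)

text \<open>
  The algebra of the inductive step, with \<open>A\<close> and \<open>B\<close> in the roles of the Lucasnomials of the two
  neighbours in Pascal's triangle: after multiplication by the denominator, the lucastorial common to
  both terms factors out and the addition formula remains.
\<close>

lemma lucastorial_recurrence:
  assumes "d \<ge> 1"
    and A: "A * (lucastorial d (Suc i) * lucastorial d q) = lucastorial d (Suc i + q)"
    and B: "B * (lucastorial d i * lucastorial d (Suc q)) = lucastorial d (Suc i + q)"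
  shows "(lucas (Suc i * d + 1) * A + t_var * lucas (Suc q * d - 1) * B)
           * (lucastorial d (Suc i) * lucastorial d (Suc q)) = lucastorial d (Suc (Suc i + q))"
proof -
  obtain b where b: "Suc q * d = Suc b"
    using assms(1) by (cases "Suc q * d") auto
  have "(lucas (Suc i * d + 1) * A + t_var * lucas b * B)
           * (lucastorial d (Suc i) * lucastorial d (Suc q))
      = lucas (Suc i * d + 1) * lucas (Suc b) * (A * (lucastorial d (Suc i) * lucastorial d q))
        + t_var * lucas (Suc i * d) * lucas b * (B * (lucastorial d i * lucastorial d (Suc q)))"
    using lucastorial_Suc[of d q] lucastorial_Suc[of d i]
    unfolding b by (simp only: algebra_simps)
  also have "\<dots> = lucas (Suc i * d + Suc b) * lucastorial d (Suc i + q)"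
    unfolding A B lucas_add by (simp add: algebra_simps)
  also have "Suc i * d + Suc b = Suc (Suc i + q) * d"
    unfolding b[symmetric] by (simp add: algebra_simps)
  finally show ?thesis
    unfolding b lucastorial_Suc[of d "Suc i + q"] by simp
qed

section \<open>Tilings of a region\<close>

text \<open>
  Tilings of an arbitrary set of boxes, so that parts of a row, a row and a stack of rows are
  treated alike.
\<close>

definition tilings :: "(nat \<times> nat) set \<Rightarrow> tile set set" where
  "tilings X = {T. (\<Union>\<tau>\<in>T. boxes \<tau>) = X \<and>
     (\<forall>\<tau>\<in>T. \<forall>\<tau>'\<in>T. \<tau> \<noteq> \<tau>' \<longrightarrow> boxes \<tau> \<inter> boxes \<tau>' = {})}"

lemma boxes_nonempty [simp]: "boxes \<tau> \<noteq> {}"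
  by (cases \<tau>) auto

lemma inj_boxes: "inj boxes"
proof
  fix \<tau> \<tau>' :: tile
  assume "boxes \<tau> = boxes \<tau>'"
  then show "\<tau> = \<tau>'"
    by (cases \<tau>; cases \<tau>') (auto simp: doubleton_eq_iff)
qed

lemma tilings_boxes_subset: "T \<in> tilings X \<Longrightarrow> \<tau> \<in> T \<Longrightarrow> boxes \<tau> \<subseteq> X"
  by (auto simp: tilings_def)

lemma tilings_disjoint:
  "T \<in> tilings X \<Longrightarrow> \<tau> \<in> T \<Longrightarrow> \<tau>' \<in> T \<Longrightarrow> b \<in> boxes \<tau> \<Longrightarrow> b \<in> boxes \<tau>' \<Longrightarrow> \<tau> = \<tau>'"
  by (auto simp: tilings_def)

lemma tilings_cover: "T \<in> tilings X \<Longrightarrow> b \<in> X \<Longrightarrow> \<exists>\<tau>\<in>T. b \<in> boxes \<tau>"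
  unfolding tilings_def by blast

lemma finite_tiles_within: "finite X \<Longrightarrow> finite {\<tau>. boxes \<tau> \<subseteq> X}"
  using finite_vimageI[OF _ inj_boxes, of "Pow X"] by (simp add: vimage_def)

lemma finite_tiling: "finite X \<Longrightarrow> T \<in> tilings X \<Longrightarrow> finite T"
  by (rule finite_subset[OF _ finite_tiles_within]) (auto dest: tilings_boxes_subset)

lemma finite_tilings: "finite X \<Longrightarrow> finite (tilings X)"
  by (rule finite_subset[of _ "Pow {\<tau>. boxes \<tau> \<subseteq> X}"])
     (auto dest: tilings_boxes_subset simp: finite_tiles_within)

lemma tilings_empty [simp]: "tilings {} = {{}}"
  by (auto simp: tilings_def)

lemma tilings_nonempty: "tilings X \<noteq> {}"
proof -
  have "(\<lambda>(a, y). Monomino a y) ` X \<in> tilings X"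
    by (auto simp: tilings_def)
  then show ?thesis by blast
qed

lemma tilings_Un:
  assumes "X \<inter> Y = {}" "A \<in> tilings X" "B \<in> tilings Y"
  shows "A \<union> B \<in> tilings (X \<union> Y)"
proof -
  have sub: "\<And>\<tau>. \<tau> \<in> A \<Longrightarrow> boxes \<tau> \<subseteq> X" "\<And>\<tau>. \<tau> \<in> B \<Longrightarrow> boxes \<tau> \<subseteq> Y"
    using assms by (auto dest: tilings_boxes_subset)
  have "boxes \<tau> \<inter> boxes \<tau>' = {}" if "\<tau> \<in> A \<union> B" "\<tau>' \<in> A \<union> B" "\<tau> \<noteq> \<tau>'" for \<tau> \<tau>'
  proof -
    consider "\<tau> \<in> A" "\<tau>' \<in> A" | "\<tau> \<in> A" "\<tau>' \<in> B" | "\<tau> \<in> B" "\<tau>' \<in> A" | "\<tau> \<in> B" "\<tau>' \<in> B"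
      using \<open>\<tau> \<in> A \<union> B\<close> \<open>\<tau>' \<in> A \<union> B\<close> by auto
    then show ?thesis
    proof cases
      case 1
      then show ?thesis using tilings_disjoint[OF assms(2)] that(3) by blast
    next
      case 4
      then show ?thesis using tilings_disjoint[OF assms(3)] that(3) by blast
    qed (use sub assms(1) in fast)+
  qed
  moreover have "(\<Union>\<tau>\<in>A \<union> B. boxes \<tau>) = X \<union> Y"
    using assms by (auto simp: tilings_def)
  ultimately show ?thesis
    by (simp add: tilings_def)
qed

lemma tilings_restrict:
  assumes "T \<in> tilings (X \<union> Y)" "X \<inter> Y = {}"
    and "\<And>\<tau>. \<tau> \<in> T \<Longrightarrow> boxes \<tau> \<subseteq> X \<or> boxes \<tau> \<subseteq> Y"
  shows "{\<tau> \<in> T. boxes \<tau> \<subseteq> X} \<in> tilings X"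
proof -
  have "(\<Union>\<tau>\<in>{\<tau> \<in> T. boxes \<tau> \<subseteq> X}. boxes \<tau>) = X"
  proof (intro equalityI subsetI)
    fix b assume "b \<in> X"
    then obtain \<tau> where "\<tau> \<in> T" "b \<in> boxes \<tau>"
      using tilings_cover[OF assms(1)] by blast
    then show "b \<in> (\<Union>\<tau>\<in>{\<tau> \<in> T. boxes \<tau> \<subseteq> X}. boxes \<tau>)"
      using assms(2) assms(3)[of \<tau>] \<open>b \<in> X\<close> by blast
  qed auto
  then show ?thesis
    using assms(1) by (auto simp: tilings_def)
qed

lemma restrict_Un:
  assumes "X \<inter> Y = {}" "A \<in> tilings X" "B \<in> tilings Y"
  shows "{\<tau> \<in> A \<union> B. boxes \<tau> \<subseteq> X} = A"
proof -
  have "\<not> boxes \<tau> \<subseteq> X" if "\<tau> \<in> B" for \<tau>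
    using tilings_boxes_subset[OF assms(3) that] assms(1) boxes_nonempty[of \<tau>] by blast
  then show ?thesis
    using tilings_boxes_subset[OF assms(2)] by auto
qed

lemma tilings_Un_eq:
  assumes "X \<inter> Y = {}"
    and "\<And>\<tau>. boxes \<tau> \<subseteq> X \<union> Y \<Longrightarrow> boxes \<tau> \<subseteq> X \<or> boxes \<tau> \<subseteq> Y"
  shows "tilings (X \<union> Y) = (\<lambda>(A, B). A \<union> B) ` (tilings X \<times> tilings Y)"
proof (intro equalityI subsetI)
  fix T assume T: "T \<in> tilings (X \<union> Y)"
  have sp: "boxes \<tau> \<subseteq> X \<or> boxes \<tau> \<subseteq> Y" if "\<tau> \<in> T" for \<tau>
    using assms(2) tilings_boxes_subset[OF T that] .
  have "{\<tau> \<in> T. boxes \<tau> \<subseteq> X} \<in> tilings X"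
    by (rule tilings_restrict[OF T assms(1) sp])
  moreover have "{\<tau> \<in> T. boxes \<tau> \<subseteq> Y} \<in> tilings Y"
    by (rule tilings_restrict[of _ _ X]) (use T assms(1) sp in \<open>auto simp: Un_commute\<close>)
  moreover have "T = {\<tau> \<in> T. boxes \<tau> \<subseteq> X} \<union> {\<tau> \<in> T. boxes \<tau> \<subseteq> Y}"
    using sp by blast
  ultimately show "T \<in> (\<lambda>(A, B). A \<union> B) ` (tilings X \<times> tilings Y)"
    by (intro image_eqI[of _ _ "({\<tau> \<in> T. boxes \<tau> \<subseteq> X}, {\<tau> \<in> T. boxes \<tau> \<subseteq> Y})"]) simp_all
qed (auto intro: tilings_Un[OF assms(1)])

text \<open>
  Deleting a fixed tile is a bijection onto the tilings of the remaining boxes.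
\<close>

lemma tilings_with_tile:
  assumes "boxes \<tau> \<subseteq> X"
  shows "{T \<in> tilings X. \<tau> \<in> T} = insert \<tau> ` tilings (X - boxes \<tau>)"
proof (intro equalityI subsetI)
  fix T assume T: "T \<in> {T \<in> tilings X. \<tau> \<in> T}"
  then have "T - {\<tau>} \<in> tilings (X - boxes \<tau>)"
    by (auto simp: tilings_def)
  moreover have "T = insert \<tau> (T - {\<tau>})"
    using T by auto
  ultimately show "T \<in> insert \<tau> ` tilings (X - boxes \<tau>)"
    by blast
next
  fix T assume "T \<in> insert \<tau> ` tilings (X - boxes \<tau>)"
  then obtain S where S: "S \<in> tilings (X - boxes \<tau>)" "T = {\<tau>} \<union> S" by auto
  have "{\<tau>} \<in> tilings (boxes \<tau>)"
    by (simp add: tilings_def)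
  then have "T \<in> tilings (boxes \<tau> \<union> (X - boxes \<tau>))"
    unfolding S(2) by (intro tilings_Un S(1)) auto
  then show "T \<in> {T \<in> tilings X. \<tau> \<in> T}"
    using assms S(2) by (simp add: Un_absorb1)
qed

section \<open>Weights of row tilings\<close>

fun tile_weight :: "tile \<Rightarrow> int poly poly" where
  "tile_weight (Monomino a y) = s_var"
| "tile_weight (Domino a y) = t_var"

definition weight :: "tile set \<Rightarrow> int poly poly" where
  "weight T = (\<Prod>\<tau>\<in>T. tile_weight \<tau>)"

lemma weight_empty [simp]: "weight {} = 1"
  by (simp add: weight_def)

lemma weight_Un: "finite A \<Longrightarrow> finite B \<Longrightarrow> A \<inter> B = {} \<Longrightarrow> weight (A \<union> B) = weight A * weight B"
  by (simp add: weight_def prod.union_disjoint)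

lemma wt_eq_weight:
  assumes "finite T"
  shows "wt (p, T) = weight T"
proof -
  let ?M = "{\<tau> \<in> T. \<exists>a y. \<tau> = Monomino a y}" and ?D = "{\<tau> \<in> T. \<exists>a y. \<tau> = Domino a y}"
  have "T = ?M \<union> ?D"
    by (auto intro: tile.exhaust)
  then have "weight T = weight (?M \<union> ?D)" by simp
  also have "\<dots> = weight ?M * weight ?D"
    by (rule weight_Un) (use assms in auto)
  also have "weight ?M = (\<Prod>\<tau>\<in>?M. s_var)"
    unfolding weight_def by (rule prod.cong) auto
  also have "weight ?D = (\<Prod>\<tau>\<in>?D. t_var)"
    unfolding weight_def by (rule prod.cong) auto
  finally show ?thesis
    by (simp add: wt_def)
qed

lemma weight_tilings_with_tile:
  assumes "finite X" "boxes \<tau> \<subseteq> X"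
  shows "(\<Sum>T | T \<in> tilings X \<and> \<tau> \<in> T. weight T)
           = tile_weight \<tau> * (\<Sum>T\<in>tilings (X - boxes \<tau>). weight T)"
proof -
  have notin: "\<tau> \<notin> T" if "T \<in> tilings (X - boxes \<tau>)" for T
    using tilings_boxes_subset[OF that] boxes_nonempty[of \<tau>] by blast
  have "(\<Sum>T | T \<in> tilings X \<and> \<tau> \<in> T. weight T)
          = (\<Sum>T\<in>tilings (X - boxes \<tau>). weight (insert \<tau> T))"
    unfolding tilings_with_tile[OF assms(2)]
    by (subst sum.reindex) (auto simp: inj_on_def dest: notin)
  also have "\<dots> = (\<Sum>T\<in>tilings (X - boxes \<tau>). tile_weight \<tau> * weight T)"
    using notin finite_tiling[of "X - boxes \<tau>"] assms(1)
    by (intro sum.cong) (auto simp: weight_def)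
  finally show ?thesis
    by (simp add: sum_distrib_left)
qed

definition segment :: "nat \<Rightarrow> nat \<Rightarrow> nat \<Rightarrow> (nat \<times> nat) set" where
  "segment a b y = {a..<b} \<times> {y}"

lemma finite_segment [simp]: "finite (segment a b y)"
  by (simp add: segment_def)

lemma segment_empty [simp]: "b \<le> a \<Longrightarrow> segment a b y = {}"
  by (simp add: segment_def)

lemma segment_minus_tile:
  "segment a b y - boxes (Monomino a y) = segment (Suc a) b y"
  "segment a b y - boxes (Domino a y) = segment (Suc (Suc a)) b y"
  by (auto simp: segment_def)

text \<open>
  Condition on the first tile: removing it leaves a shorter row, and this is the recursion of the
  Lucas sequence. The two claims are proved together because the domino half of the case distinction
  is itself the weight of the part of a row to the right of an \<open>NL\<close> step. For \<open>l = 0\<close> the domino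
  does not fit, in accordance with \<open>lucas 0 = 0\<close>; this happens for \<open>d = 1\<close>.
\<close>

lemma weight_row_tilings: "(\<Sum>T\<in>tilings (segment a (a + l) y). weight T) = lucas (Suc l)"
  and weight_row_tilings_domino:
    "(\<Sum>T | T \<in> tilings (segment a (a + Suc l) y) \<and> Domino a y \<in> T. weight T) = t_var * lucas l"
proof -
  have dom: "(\<Sum>T | T \<in> tilings (segment a (a + Suc l) y) \<and> Domino a y \<in> T. weight T)
      = t_var * lucas l"
    if IH: "\<And>m a. m < l \<Longrightarrow> (\<Sum>T\<in>tilings (segment a (a + m) y). weight T) = lucas (Suc m)" for a l
  proof (cases l)
    case 0
    have "{T. T \<in> tilings (segment a (a + Suc l) y) \<and> Domino a y \<in> T} = {}"
      using 0 by (auto simp: segment_def dest!: tilings_boxes_subset)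
    then show ?thesis
      using 0 by (simp only: sum.empty) simp
  next
    case (Suc m)
    have "boxes (Domino a y) \<subseteq> segment a (a + Suc l) y"
      using Suc by (auto simp: segment_def)
    then show ?thesis
      using IH[of m "Suc (Suc a)"] Suc
      by (simp add: weight_tilings_with_tile segment_minus_tile del: boxes.simps)
  qed
  have main: "(\<Sum>T\<in>tilings (segment a (a + l) y). weight T) = lucas (Suc l)" for a l
  proof (induction l arbitrary: a rule: less_induct)
    case (less l)
    show ?case
    proof (cases l)
      case 0
      then show ?thesis by simp
    next
      case (Suc m)
      let ?X = "segment a (a + l) y"
      have cover: "Monomino a y \<in> T \<or> Domino a y \<in> T" if T: "T \<in> tilings ?X" for T
      proof -
        have "(a, y) \<in> ?X"
          using Suc by (simp add: segment_def)
        then obtain \<tau> where "\<tau> \<in> T" "(a, y) \<in> boxes \<tau>"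
          using tilings_cover[OF T] by blast
        then show ?thesis
          using tilings_boxes_subset[OF T \<open>\<tau> \<in> T\<close>]
          by (cases \<tau>) (auto simp: segment_def)
      qed
      have excl: "\<not> (Monomino a y \<in> T \<and> Domino a y \<in> T)" if T: "T \<in> tilings ?X" for T
        using tilings_disjoint[OF T, of "Monomino a y" "Domino a y" "(a, y)"] by auto
      have "(\<Sum>T\<in>tilings ?X. weight T)
          = (\<Sum>T\<in>{T. T \<in> tilings ?X \<and> Monomino a y \<in> T} \<union> {T. T \<in> tilings ?X \<and> Domino a y \<in> T}.
               weight T)"
        using cover by (intro sum.cong) auto
      also have "\<dots> = (\<Sum>T | T \<in> tilings ?X \<and> Monomino a y \<in> T. weight T)
          + (\<Sum>T | T \<in> tilings ?X \<and> Domino a y \<in> T. weight T)"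
        using excl by (intro sum.union_disjoint) (auto simp: finite_tilings)
      also have "(\<Sum>T | T \<in> tilings ?X \<and> Monomino a y \<in> T. weight T) = s_var * lucas (Suc m)"
      proof -
        have "boxes (Monomino a y) \<subseteq> ?X"
          using Suc by (simp add: segment_def)
        then show ?thesis
          using less.IH[of m "Suc a"] Suc
          by (simp add: weight_tilings_with_tile segment_minus_tile del: boxes.simps)
      qed
      also have "(\<Sum>T | T \<in> tilings ?X \<and> Domino a y \<in> T. weight T) = t_var * lucas m"
        using dom[of m a] less.IH Suc by simp
      finally show ?thesis
        using Suc by simp
    qed
  qed
  show "(\<Sum>T\<in>tilings (segment a (a + l) y). weight T) = lucas (Suc l)"
    by (rule main)
  show "(\<Sum>T | T \<in> tilings (segment a (a + Suc l) y) \<and> Domino a y \<in> T. weight T) = t_var * lucas l"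
    by (rule dom) (rule main)
qed

text \<open>
  Only a domino across the vertical line at \<open>x\<close> keeps a row tiling from splitting there.
\<close>

lemma tile_splits_at:
  assumes "boxes \<tau> \<subseteq> segment a c y" "\<And>u. x = Suc u \<Longrightarrow> \<tau> \<noteq> Domino u y"
  shows "boxes \<tau> \<subseteq> segment a x y \<or> boxes \<tau> \<subseteq> segment x c y"
proof (cases \<tau>)
  case (Monomino u z)
  then show ?thesis
    using assms(1) by (cases "u < x") (auto simp: segment_def)
next
  case (Domino u z)
  then have "x \<noteq> Suc u"
    using assms by (auto simp: segment_def)
  then show ?thesis
    using assms(1) Domino by (cases "u < x") (auto simp: segment_def)
qed

lemma segment_split: "a \<le> x \<Longrightarrow> x \<le> c \<Longrightarrow> segment a c y = segment a x y \<union> segment x c y"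
  by (auto simp: segment_def)

lemma segment_disjoint: "segment a x y \<inter> segment x c y = {}"
  by (auto simp: segment_def)

section \<open>Peeling off the bottom row\<close>

definition upper_staircase :: "nat \<Rightarrow> nat \<Rightarrow> nat \<Rightarrow> (nat \<times> nat) set" where
  "upper_staircase d n y = {b \<in> staircase d n. y \<le> snd b}"

definition kept :: "step list \<Rightarrow> tile set \<Rightarrow> tile set" where
  "kept p T = {\<tau> \<in> T. \<exists>\<sigma>\<in>set p. kept_by \<sigma> \<tau>}"

text \<open>
  The part of the construction that concerns the rows from \<open>y\<close> upwards, for a path that enters them
  at \<open>(j * d, y)\<close>. This is the object on which the induction over the rows runs.
\<close>

definition partial_from :: "nat \<Rightarrow> nat \<Rightarrow> nat \<Rightarrow> nat \<Rightarrow> tile set \<Rightarrow> partial_tiling" where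
  "partial_from d n j y T = (path_from d n T j y, kept (path_from d n T j y) T)"

definition partials :: "nat \<Rightarrow> nat \<Rightarrow> nat \<Rightarrow> nat \<Rightarrow> partial_tiling set" where
  "partials d n j y = partial_from d n j y ` tilings (upper_staircase d n y)"

definition attach :: "step list \<Rightarrow> tile set \<times> partial_tiling \<Rightarrow> partial_tiling" where
  "attach ss = (\<lambda>(R, p, K). (ss @ p, R \<union> K))"

lemma partial_tilings_eq_partials: "partial_tilings d n k = partials d n k 0"
  by (auto simp: partial_tilings_def partials_def partial_from_def partial_tiling_of_def
      kept_def is_tiling_def tilings_def upper_staircase_def Let_def)

lemma finite_upper_staircase [simp]: "finite (upper_staircase d n y)"
proof (rule finite_subset)
  show "upper_staircase d n y \<subseteq> {..<n * d} \<times> {..<n}"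
  proof
    fix b assume "b \<in> upper_staircase d n y"
    then obtain a z where b: "b = (a, z)" "z < n" "a < (n - z) * d - 1"
      by (auto simp: upper_staircase_def staircase_def row_length_def)
    moreover have "(n - z) * d \<le> n * d" by simp
    ultimately have "a < n * d" by linarith
    then show "b \<in> {..<n * d} \<times> {..<n}" using b by simp
  qed
qed simp

lemma finite_partials [simp]: "finite (partials d n j y)"
  by (simp add: partials_def finite_tilings)

lemma upper_staircase_Suc:
  "y < n \<Longrightarrow> upper_staircase d n y = segment 0 (row_length d n y) y \<union> upper_staircase d n (Suc y)"
  by (auto simp: upper_staircase_def staircase_def segment_def le_less Suc_le_eq)

lemma tile_in_one_row: "b \<in> boxes \<tau> \<Longrightarrow> b' \<in> boxes \<tau> \<Longrightarrow> snd b = snd b'"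
  by (cases \<tau>) auto

lemma segment_upper_disjoint: "segment a c y \<inter> upper_staircase d n (Suc y) = {}"
  by (auto simp: segment_def upper_staircase_def)

lemma tilings_upper_staircase_Suc:
  assumes "y < n"
  shows "tilings (upper_staircase d n y) = (\<lambda>(R, T). R \<union> T) `
    (tilings (segment 0 (row_length d n y) y) \<times> tilings (upper_staircase d n (Suc y)))"
  unfolding upper_staircase_Suc[OF assms]
proof (rule tilings_Un_eq[OF segment_upper_disjoint])
  fix \<tau>
  assume sub: "boxes \<tau> \<subseteq> segment 0 (row_length d n y) y \<union> upper_staircase d n (Suc y)"
  show "boxes \<tau> \<subseteq> segment 0 (row_length d n y) y \<or> boxes \<tau> \<subseteq> upper_staircase d n (Suc y)"
  proof (rule ccontr)
    assume "\<not> ?thesis"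
    then obtain b b' where "b \<in> boxes \<tau>" "b \<in> upper_staircase d n (Suc y)"
      "b' \<in> boxes \<tau>" "b' \<in> segment 0 (row_length d n y) y"
      using sub by blast
    then show False
      using tile_in_one_row[of b \<tau> b'] by (auto simp: segment_def upper_staircase_def)
  qed
qed

text \<open>
  The path only looks at dominoes in the rows that it has yet to cross.
\<close>

lemma path_from_cong:
  "(\<And>a z. y \<le> z \<Longrightarrow> Domino a z \<in> T \<longleftrightarrow> Domino a z \<in> T') \<Longrightarrow>
     path_from d n T j y = path_from d n T' j y"
proof (induction d n T j y rule: path_from.induct)
  case (1 d n T j y)
  have cr: "crosses_domino T (j * d) y = crosses_domino T' (j * d) y"
    using "1.prems"[of y] by (simp add: crosses_domino_def)
  show ?case
    using 1 cr by (subst (1 2) path_from.simps) auto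
qed

text \<open>
  Together with the previous lemma this decouples a row from the rows above it: the later steps
  neither see nor keep its tiles.
\<close>

lemma kept_by_path_from:
  "\<sigma> \<in> set (path_from d n T j y) \<Longrightarrow> kept_by \<sigma> \<tau> \<Longrightarrow> b \<in> boxes \<tau> \<Longrightarrow> y \<le> snd b"
proof (induction d n T j y rule: path_from.induct)
  case (1 d n T j y)
  note IH = "1.IH" and prems = "1.prems"
  show ?case
  proof (cases "n \<le> y")
    case True
    then show ?thesis using prems by (simp add: path_from.simps)
  next
    case less: False
    show ?thesis
    proof (cases "north_in_diagram d n (j * d) y \<and> \<not> crosses_domino T (j * d) y")
      case True
      have "\<sigma> = NI (j * d) y \<or> \<sigma> \<in> set (path_from d n T j (y + 1))"
        using prems(1) less True by (subst (asm) path_from.simps) simp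
      then show ?thesis
      proof
        assume "\<sigma> = NI (j * d) y"
        then show ?thesis using prems by fastforce
      next
        assume "\<sigma> \<in> set (path_from d n T j (y + 1))"
        then show ?thesis using IH(1)[OF less True] prems(2,3) by simp
      qed
    next
      case False
      have "(\<exists>u z. \<sigma> = West u z) \<or> \<sigma> = NL (j * d - 1) y \<or> \<sigma> \<in> set (path_from d n T (j - 1) (y + 1))"
        using prems(1) less False by (subst (asm) path_from.simps) auto
      then consider u z where "\<sigma> = West u z" | "\<sigma> = NL (j * d - 1) y"
        | "\<sigma> \<in> set (path_from d n T (j - 1) (y + 1))" by blast
      then show ?thesis
      proof cases
        case 1
        then show ?thesis using prems by simp
      next
        case 2
        then show ?thesis using prems by fastforce
      next
        case 3
        then show ?thesis using IH(2)[OF less False] prems(2,3) by simp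
      qed
    qed
  qed
qed

lemma partials_tiles:
  assumes "(p, K) \<in> partials d n j y"
  shows "finite K" "\<tau> \<in> K \<Longrightarrow> b \<in> boxes \<tau> \<Longrightarrow> y \<le> snd b"
proof -
  obtain T where T: "T \<in> tilings (upper_staircase d n y)" "K \<subseteq> T"
    using assms by (auto simp: partials_def partial_from_def kept_def)
  show "finite K"
    using finite_subset[OF T(2) finite_tiling[OF finite_upper_staircase T(1)]] .
  show "y \<le> snd b" if "\<tau> \<in> K" "b \<in> boxes \<tau>"
    using tilings_boxes_subset[OF T(1), of \<tau>] that T(2) by (auto simp: upper_staircase_def)
qed

definition west_north :: "nat \<Rightarrow> nat \<Rightarrow> nat \<Rightarrow> step list" where
  "west_north d j y = West (j * d) y # NL (j * d - 1) y
     # map (\<lambda>i. West (j * d - 1 - i) (y + 1)) [0..<d - 1]"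

lemma partial_from_Un:
  assumes "y < n" and R: "R \<in> tilings (segment 0 (row_length d n y) y)"
    and T: "T \<in> tilings (upper_staircase d n (Suc y))"
  shows "partial_from d n j y (R \<union> T) =
    (if north_in_diagram d n (j * d) y \<and> \<not> crosses_domino R (j * d) y
     then attach [NI (j * d) y] ({\<tau> \<in> R. kept_by (NI (j * d) y) \<tau>}, partial_from d n j (Suc y) T)
     else attach (west_north d j y)
            ({\<tau> \<in> R. kept_by (NL (j * d - 1) y) \<tau>}, partial_from d n (j - 1) (Suc y) T))"
proof -
  have rowR: "snd b = y" if "\<tau> \<in> R" "b \<in> boxes \<tau>" for \<tau> b
    using tilings_boxes_subset[OF R that(1)] that(2) by (auto simp: segment_def)
  have rowT: "Suc y \<le> snd b" if "\<tau> \<in> T" "b \<in> boxes \<tau>" for \<tau> b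
    using tilings_boxes_subset[OF T that(1)] that(2) by (auto simp: upper_staircase_def)
  have cr: "crosses_domino (R \<union> T) x y = crosses_domino R x y" for x
    using rowT[of "Domino _ y"] by (fastforce simp: crosses_domino_def)
  have path: "path_from d n (R \<union> T) i (Suc y) = path_from d n T i (Suc y)" for i
    using rowR[of "Domino _ _"] by (intro path_from_cong) fastforce
  have later: "kept (path_from d n T i (Suc y)) (R \<union> T) = kept (path_from d n T i (Suc y)) T" for i
  proof -
    have "\<not> kept_by \<sigma> \<tau>" if "\<tau> \<in> R" "\<sigma> \<in> set (path_from d n T i (Suc y))" for \<tau> \<sigma>
    proof
      assume kb: "kept_by \<sigma> \<tau>"
      obtain b where "b \<in> boxes \<tau>"
        using boxes_nonempty[of \<tau>] by blast
      then show False
        using kept_by_path_from[OF that(2) kb] rowR[OF that(1)] by fastforce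
    qed
    then show ?thesis by (auto simp: kept_def)
  qed
  have notT: "\<not> kept_by (NI x y) \<tau>" "\<not> kept_by (NL x y) \<tau>" if "\<tau> \<in> T" for x \<tau>
  proof -
    obtain a z where "(a, z) \<in> boxes \<tau>"
      using boxes_nonempty[of \<tau>] by fastforce
    then show "\<not> kept_by (NI x y) \<tau>" "\<not> kept_by (NL x y) \<tau>"
      using rowT[OF that] by fastforce+
  qed
  show ?thesis
  proof (cases "north_in_diagram d n (j * d) y \<and> \<not> crosses_domino R (j * d) y")
    case True
    have p: "path_from d n (R \<union> T) j y = NI (j * d) y # path_from d n T j (Suc y)"
      using True assms(1) cr path by (subst path_from.simps) auto
    have "kept (NI (j * d) y # path_from d n T j (Suc y)) (R \<union> T)
        = {\<tau> \<in> R \<union> T. kept_by (NI (j * d) y) \<tau>} \<union> kept (path_from d n T j (Suc y)) (R \<union> T)"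
      by (auto simp: kept_def)
    also have "{\<tau> \<in> R \<union> T. kept_by (NI (j * d) y) \<tau>} = {\<tau> \<in> R. kept_by (NI (j * d) y) \<tau>}"
      using notT by blast
    finally show ?thesis
      using True by (simp add: partial_from_def attach_def p later)
  next
    case False
    have p: "path_from d n (R \<union> T) j y = west_north d j y @ path_from d n T (j - 1) (Suc y)"
      using False assms(1) cr path by (subst path_from.simps) (auto simp: west_north_def)
    have "kept (west_north d j y @ path_from d n T (j - 1) (Suc y)) (R \<union> T)
        = {\<tau> \<in> R \<union> T. kept_by (NL (j * d - 1) y) \<tau>}
          \<union> kept (path_from d n T (j - 1) (Suc y)) (R \<union> T)"
      by (auto simp: kept_def west_north_def)
    also have "{\<tau> \<in> R \<union> T. kept_by (NL (j * d - 1) y) \<tau>} = {\<tau> \<in> R. kept_by (NL (j * d - 1) y) \<tau>}"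
      using notT by blast
    finally show ?thesis
      unfolding if_not_P[OF False]
      by (simp add: partial_from_def attach_def p later)
  qed
qed

lemma kept_by_NI_iff: "kept_by (NI x y) \<tau> \<longleftrightarrow> boxes \<tau> \<subseteq> segment 0 x y"
  by (auto simp: segment_def subset_iff Suc_le_eq)

lemma kept_by_NL_iff:
  assumes "boxes \<tau> \<subseteq> segment 0 c y"
  shows "kept_by (NL x y) \<tau> \<longleftrightarrow> boxes \<tau> \<subseteq> segment x c y"
  using assms by (auto simp: segment_def subset_iff)

text \<open>
  Any tiling of the boxes to the left of the step occurs, because the rest of the row can be filled
  with monominoes, none of which crosses the line at \<open>x\<close>.
\<close>

lemma NI_rows:
  assumes "x \<le> c"
  shows "(\<lambda>R. {\<tau> \<in> R. kept_by (NI x y) \<tau>}) ` {R \<in> tilings (segment 0 c y). \<not> crosses_domino R x y}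
       = tilings (segment 0 x y)"
proof (intro equalityI subsetI)
  fix L assume "L \<in> (\<lambda>R. {\<tau> \<in> R. kept_by (NI x y) \<tau>}) `
    {R \<in> tilings (segment 0 c y). \<not> crosses_domino R x y}"
  then obtain R where R: "R \<in> tilings (segment 0 c y)" "\<not> crosses_domino R x y"
    and L: "L = {\<tau> \<in> R. boxes \<tau> \<subseteq> segment 0 x y}"
    by (auto simp del: kept_by.simps simp: kept_by_NI_iff)
  show "L \<in> tilings (segment 0 x y)"
    unfolding L
  proof (rule tilings_restrict[OF _ segment_disjoint])
    show "R \<in> tilings (segment 0 x y \<union> segment x c y)"
      using R(1) segment_split[of 0 x c y] assms by simp
    show "boxes \<tau> \<subseteq> segment 0 x y \<or> boxes \<tau> \<subseteq> segment x c y" if "\<tau> \<in> R" for \<tau>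
      using R that by (intro tile_splits_at) (auto simp: crosses_domino_def dest: tilings_boxes_subset)
  qed
next
  fix L assume L: "L \<in> tilings (segment 0 x y)"
  obtain M where M: "M \<in> tilings (segment x c y)"
    using tilings_nonempty by blast
  have "L \<union> M \<in> tilings (segment 0 c y)"
    using tilings_Un[OF segment_disjoint L M] segment_split[of 0 x c y] assms by simp
  moreover have "\<not> crosses_domino (L \<union> M) x y"
    using tilings_boxes_subset[OF L, of "Domino _ y"] tilings_boxes_subset[OF M, of "Domino _ y"]
    by (fastforce simp: crosses_domino_def segment_def)
  moreover have "L = {\<tau> \<in> L \<union> M. kept_by (NI x y) \<tau>}"
    unfolding kept_by_NI_iff using restrict_Un[OF segment_disjoint L M] by simp
  ultimately show "L \<in> (\<lambda>R. {\<tau> \<in> R. kept_by (NI x y) \<tau>}) `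
    {R \<in> tilings (segment 0 c y). \<not> crosses_domino R x y}"
    by blast
qed

text \<open>
  Here \<open>x\<close> is the abscissa of the \<open>NL\<close> step, so that the line at which the direct north step was
  blocked is \<open>x + 1\<close> and the blocking domino starts at \<open>x\<close>. As no other tile can then cover the box
  at \<open>x\<close>, the row splits at \<open>x\<close>. If the boundary did the blocking, \<open>x\<close> is the right end of the row.
  The predicate \<open>A\<close> stands for the condition under which the path makes the \<open>NL\<close> step.
\<close>

lemma NL_rows:
  assumes "x \<le> c"
    and "\<And>R. R \<in> tilings (segment 0 c y) \<Longrightarrow> A R \<longleftrightarrow> x = c \<or> Domino x y \<in> R"
  shows "(\<lambda>R. {\<tau> \<in> R. kept_by (NL x y) \<tau>}) ` {R \<in> tilings (segment 0 c y). A R}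
       = {R \<in> tilings (segment x c y). x = c \<or> Domino x y \<in> R}"
proof (intro equalityI subsetI)
  fix L assume "L \<in> (\<lambda>R. {\<tau> \<in> R. kept_by (NL x y) \<tau>}) ` {R \<in> tilings (segment 0 c y). A R}"
  then obtain R where R: "R \<in> tilings (segment 0 c y)" "x = c \<or> Domino x y \<in> R"
    and L: "L = {\<tau> \<in> R. kept_by (NL x y) \<tau>}"
    using assms(2) by auto
  have L': "L = {\<tau> \<in> R. boxes \<tau> \<subseteq> segment x c y}"
    unfolding L using kept_by_NL_iff tilings_boxes_subset[OF R(1)] by blast
  have "L \<in> tilings (segment x c y)"
    unfolding L'
  proof (rule tilings_restrict[where Y = "segment 0 x y"])
    show "R \<in> tilings (segment x c y \<union> segment 0 x y)"
      using R(1) segment_split[of 0 x c y] assms(1) by (simp add: Un_commute)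
    show "segment x c y \<inter> segment 0 x y = {}"
      using segment_disjoint by blast
    fix \<tau> assume \<tau>: "\<tau> \<in> R"
    \<comment> \<open>A domino across the line at \<open>x\<close> would sit on the box at \<open>x\<close>, which lies outside the row or
      already belongs to the blocking domino.\<close>
    have "\<tau> \<noteq> Domino u y" if "x = Suc u" for u
    proof
      assume "\<tau> = Domino u y"
      then have "(Suc u, y) \<in> segment 0 c y"
        using tilings_boxes_subset[OF R(1) \<tau>] by auto
      then have "Domino x y \<in> R"
        using R(2) that by (auto simp: segment_def)
      then show False
        using tilings_disjoint[OF R(1) \<tau>, of "Domino x y" "(x, y)"] that \<open>\<tau> = Domino u y\<close> by simp
    qed
    then show "boxes \<tau> \<subseteq> segment x c y \<or> boxes \<tau> \<subseteq> segment 0 x y"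
      using tile_splits_at[OF tilings_boxes_subset[OF R(1) \<tau>], of x] by blast
  qed
  moreover have "x = c \<or> Domino x y \<in> L"
    using R(2) tilings_boxes_subset[OF R(1), of "Domino x y"] unfolding L' by (auto simp: segment_def)
  ultimately show "L \<in> {R \<in> tilings (segment x c y). x = c \<or> Domino x y \<in> R}" by simp
next
  fix L assume "L \<in> {R \<in> tilings (segment x c y). x = c \<or> Domino x y \<in> R}"
  then have L: "L \<in> tilings (segment x c y)" "x = c \<or> Domino x y \<in> L" by auto
  obtain M where M: "M \<in> tilings (segment 0 x y)"
    using tilings_nonempty by blast
  have R: "M \<union> L \<in> tilings (segment 0 c y)"
    using tilings_Un[OF segment_disjoint M L(1)] segment_split[of 0 x c y] assms(1) by simp
  moreover have "A (M \<union> L)"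
    using assms(2)[OF R] L(2) by blast
  moreover have "L = {\<tau> \<in> M \<union> L. kept_by (NL x y) \<tau>}"
  proof -
    have "{\<tau> \<in> M \<union> L. kept_by (NL x y) \<tau>} = {\<tau> \<in> L \<union> M. boxes \<tau> \<subseteq> segment x c y}"
      using kept_by_NL_iff tilings_boxes_subset[OF R] by blast
    also have "\<dots> = L"
      by (rule restrict_Un[OF _ L(1) M]) (use segment_disjoint in blast)
    finally show ?thesis by simp
  qed
  ultimately show "L \<in> (\<lambda>R. {\<tau> \<in> R. kept_by (NL x y) \<tau>}) ` {R \<in> tilings (segment 0 c y). A R}"
    by blast
qed

text \<open>
  What an \<open>NL\<close> step can keep in its row. At the right end of the row the segment is empty and the
  only element is the empty tiling; otherwise the segment begins with the blocking domino.
\<close>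

definition NL_tilings :: "nat \<Rightarrow> nat \<Rightarrow> nat \<Rightarrow> nat \<Rightarrow> tile set set" where
  "NL_tilings d n j y = {R \<in> tilings (segment (j * d - 1) (row_length d n y) y).
     j * d - 1 = row_length d n y \<or> Domino (j * d - 1) y \<in> R}"

lemma row_length_bounds:
  assumes "d \<ge> 1" "y < n"
  shows "j < n - y \<Longrightarrow> j * d \<le> row_length d n y"
    and "j = n - y \<Longrightarrow> Suc (row_length d n y) = j * d"
proof -
  show "Suc (row_length d n y) = j * d" if "j = n - y"
    using that assms by (simp add: row_length_def)
  assume "j < n - y"
  then have "Suc j * d \<le> (n - y) * d"
    by (intro mult_le_mono1) simp
  then show "j * d \<le> row_length d n y"
    using assms by (simp add: row_length_def)
qed

text \<open>
  A map on a product that branches on the first component only, and treats the components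
  separately in each branch, has as image the union of two images of products.
\<close>

lemma image_if_Times:
  "(\<lambda>(R, T). if P R then f (u R, p T) else g (v R, q T)) ` (A \<times> B)
     = f ` (u ` {R \<in> A. P R} \<times> p ` B) \<union> g ` (v ` {R \<in> A. \<not> P R} \<times> q ` B)"
proof (intro equalityI subsetI)
  fix z assume "z \<in> f ` (u ` {R \<in> A. P R} \<times> p ` B) \<union> g ` (v ` {R \<in> A. \<not> P R} \<times> q ` B)"
  then consider R T where "R \<in> A" "T \<in> B" "P R" "z = f (u R, p T)"
    | R T where "R \<in> A" "T \<in> B" "\<not> P R" "z = g (v R, q T)"
    by auto
  then show "z \<in> (\<lambda>(R, T). if P R then f (u R, p T) else g (v R, q T)) ` (A \<times> B)"
    by cases (auto intro!: image_eqI[of _ _ "(_, _)"])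
qed auto

text \<open>
  The set of partial tilings splits by the kind of the first north step, and each part is a product
  of the choices in that row and the partial tilings of the rows above.
\<close>

lemma partials_Suc:
  assumes "d \<ge> 1" "y < n" "j \<le> n - y"
  shows "partials d n j y =
    (if j < n - y then attach [NI (j * d) y] ` (tilings (segment 0 (j * d) y) \<times> partials d n j (Suc y))
     else {}) \<union>
    (if 0 < j then attach (west_north d j y) ` (NL_tilings d n j y \<times> partials d n (j - 1) (Suc y))
     else {})"
proof -
  let ?c = "row_length d n y" and ?x = "j * d"
  let ?rows = "tilings (segment 0 ?c y)" and ?U = "tilings (upper_staircase d n (Suc y))"
  let ?go = "\<lambda>R. north_in_diagram d n ?x y \<and> \<not> crosses_domino R ?x y"
  let ?left = "\<lambda>R. {\<tau> \<in> R. kept_by (NI ?x y) \<tau>}" and ?right = "\<lambda>R. {\<tau> \<in> R. kept_by (NL (?x - 1) y) \<tau>}"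
  have in_diag: "north_in_diagram d n ?x y \<longleftrightarrow> j < n - y"
    using row_length_bounds[OF assms(1,2), of j] assms(2,3)
    by (cases "j = n - y") (auto simp: north_in_diagram_def)
  have "partials d n j y = (\<lambda>(R, T). partial_from d n j y (R \<union> T)) ` (?rows \<times> ?U)"
    unfolding partials_def tilings_upper_staircase_Suc[OF assms(2)] image_image
    by (simp add: case_prod_unfold)
  also have "\<dots> = (\<lambda>(R, T). if ?go R then attach [NI ?x y] (?left R, partial_from d n j (Suc y) T)
       else attach (west_north d j y) (?right R, partial_from d n (j - 1) (Suc y) T)) ` (?rows \<times> ?U)"
    using partial_from_Un[OF assms(2)] by (intro image_cong) auto
  also have "\<dots> = attach [NI ?x y] ` (?left ` {R \<in> ?rows. ?go R} \<times> partials d n j (Suc y))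
      \<union> attach (west_north d j y) ` (?right ` {R \<in> ?rows. \<not> ?go R} \<times> partials d n (j - 1) (Suc y))"
    unfolding partials_def by (rule image_if_Times)
  also have "attach [NI ?x y] ` (?left ` {R \<in> ?rows. ?go R} \<times> partials d n j (Suc y))
      = (if j < n - y then attach [NI ?x y] ` (tilings (segment 0 ?x y) \<times> partials d n j (Suc y)) else {})"
    using NI_rows[OF row_length_bounds(1)[OF assms(1,2)], of j] in_diag by simp
  also have "attach (west_north d j y) ` (?right ` {R \<in> ?rows. \<not> ?go R} \<times> partials d n (j - 1) (Suc y))
      = (if 0 < j then attach (west_north d j y) ` (NL_tilings d n j y \<times> partials d n (j - 1) (Suc y))
         else {})"
  proof (cases "0 < j")
    case True
    then have pos: "0 < ?x" using assms(1) by simp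
    have "?right ` {R \<in> ?rows. \<not> ?go R} = NL_tilings d n j y"
      unfolding NL_tilings_def
    proof (rule NL_rows)
      show "?x - 1 \<le> ?c"
        using row_length_bounds[OF assms(1,2), of j] assms(3) by (cases "j = n - y") auto
      fix R assume R: "R \<in> ?rows"
      show "\<not> ?go R \<longleftrightarrow> ?x - 1 = ?c \<or> Domino (?x - 1) y \<in> R"
      proof (cases "j = n - y")
        case True
        then have "?x - 1 = ?c"
          using row_length_bounds(2)[OF assms(1,2) True] by linarith
        then show ?thesis
          using in_diag True by blast
      next
        case False
        then have "?x \<le> ?c"
          using row_length_bounds(1)[OF assms(1,2), of j] assms(3) by simp
        then have "?x - 1 \<noteq> ?c" using pos by linarith
        moreover have "crosses_domino R ?x y \<longleftrightarrow> Domino (?x - 1) y \<in> R"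
          using pos unfolding crosses_domino_def by (metis Suc_eq_plus1 Suc_pred diff_Suc_1)
        ultimately show ?thesis
          using in_diag False assms(3) by auto
      qed
    qed
    then show ?thesis using True by simp
  next
    case False
    \<comment> \<open>On the \<open>y\<close>-axis nothing can block the north step.\<close>
    then have "{R \<in> ?rows. \<not> ?go R} = {}"
      using assms(2) by (auto simp: north_in_diagram_def crosses_domino_def)
    then show ?thesis using False by (simp only: image_empty Sigma_empty1) simp
  qed
  finally show ?thesis .
qed

text \<open>
  No two pairs give the same result, since the kept tiles of the bottom row can be told from the
  others by their height. Hence partial tilings, which are counted once each, are counted correctly
  by the product.
\<close>

lemma attach_weight:
  assumes "\<R> \<subseteq> tilings (segment a c y)"
  shows "(\<Sum>P\<in>attach ss ` (\<R> \<times> partials d n i (Suc y)). weight (snd P))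
       = (\<Sum>R\<in>\<R>. weight R) * (\<Sum>P\<in>partials d n i (Suc y). weight (snd P))"
proof -
  let ?Q = "partials d n i (Suc y)"
  have rowR: "{\<tau> \<in> R. boxes \<tau> \<subseteq> UNIV \<times> {y}} = R" if "R \<in> \<R>" for R
    using assms that by (fastforce simp: segment_def dest: tilings_boxes_subset)
  have rowK: "{\<tau> \<in> snd P. boxes \<tau> \<subseteq> UNIV \<times> {y}} = {}" if P: "P \<in> ?Q" for P
  proof -
    have "\<not> boxes \<tau> \<subseteq> UNIV \<times> {y}" if "\<tau> \<in> snd P" for \<tau>
    proof -
      obtain b where "b \<in> boxes \<tau>" using boxes_nonempty[of \<tau>] by blast
      then have "Suc y \<le> snd b"
        using partials_tiles(2)[of "fst P" "snd P"] P that by auto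
      then show ?thesis
        using \<open>b \<in> boxes \<tau>\<close> by auto
    qed
    then show ?thesis by blast
  qed
  have disj: "R \<inter> snd P = {}" if "R \<in> \<R>" "P \<in> ?Q" for R P
    using rowR[OF that(1)] rowK[OF that(2)] by blast
  have row: "{\<tau> \<in> R \<union> snd P. boxes \<tau> \<subseteq> UNIV \<times> {y}} = R" if "R \<in> \<R>" "P \<in> ?Q" for R P
    using rowR[OF that(1)] rowK[OF that(2)] by blast
  have inj: "inj_on (attach ss) (\<R> \<times> ?Q)"
  proof (rule inj_onI)
    fix u v assume "u \<in> \<R> \<times> ?Q" "v \<in> \<R> \<times> ?Q" and eq: "attach ss u = attach ss v"
    then obtain R P R' P' where uv: "u = (R, P)" "v = (R', P')"
      and mem: "R \<in> \<R>" "P \<in> ?Q" "R' \<in> \<R>" "P' \<in> ?Q" by auto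
    have fst: "fst P = fst P'" and un: "R \<union> snd P = R' \<union> snd P'"
      using eq by (auto simp: uv attach_def case_prod_unfold)
    have "R = R'"
      using row[OF mem(1,2)] row[OF mem(3,4)] un by simp
    then have "snd P = snd P'"
      using un disj[OF mem(1,2)] disj[OF mem(3,4)] by blast
    then show "u = v"
      using uv fst \<open>R = R'\<close> by (simp add: prod_eq_iff)
  qed
  have "(\<Sum>P\<in>attach ss ` (\<R> \<times> ?Q). weight (snd P)) = (\<Sum>(R, P)\<in>\<R> \<times> ?Q. weight R * weight (snd P))"
    unfolding sum.reindex[OF inj]
  proof (rule sum.cong[OF refl], clarify)
    fix R p K assume mem: "R \<in> \<R>" "(p, K) \<in> ?Q"
    have "finite R"
      using mem(1) assms finite_tiling by (meson finite_segment subsetD)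
    moreover have "finite K"
      using mem(2) by (rule partials_tiles)
    ultimately show "((\<lambda>P. weight (snd P)) \<circ> attach ss) (R, p, K) = weight R * weight (snd (p, K))"
      using disj[OF mem] by (simp add: attach_def weight_Un)
  qed
  then show ?thesis
    by (simp add: sum_product sum.cartesian_product)
qed

section \<open>The Pascal recurrence for the weight sums\<close>

definition partials_weight :: "nat \<Rightarrow> nat \<Rightarrow> nat \<Rightarrow> nat \<Rightarrow> int poly poly" where
  "partials_weight d n j y = (\<Sum>P\<in>partials d n j y. weight (snd P))"

lemma partials_weight_Suc:
  assumes "d \<ge> 1" "y < n" "j \<le> n - y"
  shows "partials_weight d n j y =
    (if j < n - y then lucas (Suc (j * d)) * partials_weight d n j (Suc y) else 0) +
    (if 0 < j then (\<Sum>R\<in>NL_tilings d n j y. weight R) * partials_weight d n (j - 1) (Suc y) else 0)"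
proof -
  let ?A = "attach [NI (j * d) y] ` (tilings (segment 0 (j * d) y) \<times> partials d n j (Suc y))"
  let ?B = "attach (west_north d j y) ` (NL_tilings d n j y \<times> partials d n (j - 1) (Suc y))"
  have fin: "finite ?A" "finite ?B"
    by (simp_all add: finite_tilings NL_tilings_def)
  have disj: "?A \<inter> ?B = {}"
    by (auto simp: attach_def west_north_def)
  have "partials_weight d n j y = (\<Sum>P\<in>(if j < n - y then ?A else {}). weight (snd P))
      + (\<Sum>P\<in>(if 0 < j then ?B else {}). weight (snd P))"
    unfolding partials_weight_def partials_Suc[OF assms]
    by (rule sum.union_disjoint) (use fin disj in auto)
  also have "(\<Sum>P\<in>(if j < n - y then ?A else {}). weight (snd P))
      = (if j < n - y then lucas (Suc (j * d)) * partials_weight d n j (Suc y) else 0)"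
    using attach_weight[where \<R> = "tilings (segment 0 (j * d) y)", OF subset_refl] weight_row_tilings[of 0 "j * d" y]
    by (simp add: partials_weight_def)
  also have "(\<Sum>P\<in>(if 0 < j then ?B else {}). weight (snd P))
      = (if 0 < j then (\<Sum>R\<in>NL_tilings d n j y. weight R) * partials_weight d n (j - 1) (Suc y) else 0)"
    using attach_weight[of "NL_tilings d n j y" "j * d - 1" "row_length d n y" y]
    by (simp add: partials_weight_def NL_tilings_def)
  finally show ?thesis .
qed

lemma weight_NL_tilings:
  assumes "d \<ge> 1" "y < n" "0 < j" "j \<le> n - y"
  shows "(\<Sum>R\<in>NL_tilings d n j y. weight R)
       = (if j < n - y then t_var * lucas ((n - y - j) * d - 1) else 1)"
proof (cases "j = n - y")
  case True
  then have "j * d - 1 = row_length d n y"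
    using row_length_bounds(2)[OF assms(1,2) True] by simp
  then show ?thesis
    using True by (simp add: NL_tilings_def)
next
  case False
  have pos: "0 < j * d" "0 < (n - y - j) * d"
    using False assms by simp_all
  have "(n - y) * d = j * d + (n - y - j) * d"
    using assms(4) by (metis add_mult_distrib le_add_diff_inverse)
  then have len: "row_length d n y = (j * d - 1) + Suc ((n - y - j) * d - 1)"
    using pos by (simp add: row_length_def)
  then have "NL_tilings d n j y = {R. R \<in> tilings (segment (j * d - 1)
      ((j * d - 1) + Suc ((n - y - j) * d - 1)) y) \<and> Domino (j * d - 1) y \<in> R}"
    unfolding NL_tilings_def by auto
  then show ?thesis
    using False assms(4) by (simp only: weight_row_tilings_domino) simp
qed

lemma partials_weight_lucastorial:
  assumes "d \<ge> 1" "y + m = n" "j \<le> m"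
  shows "partials_weight d n j y * (lucastorial d j * lucastorial d (m - j)) = lucastorial d m"
  using assms(2,3)
proof (induction m arbitrary: y j)
  case 0
  have "upper_staircase d n y = {}"
    using 0 by (auto simp: upper_staircase_def staircase_def)
  then have "partials d n j y = {([], {})}"
    using 0 by (simp add: partials_def partial_from_def kept_def path_from.simps)
  then show ?case
    using 0 by (simp add: partials_weight_def)
next
  case (Suc m)
  have y: "y < n" "n - y = Suc m" and IH: "\<And>i. i \<le> m \<Longrightarrow>
      partials_weight d n i (Suc y) * (lucastorial d i * lucastorial d (m - i)) = lucastorial d m"
    using Suc.prems(1) Suc.IH[of "Suc y"] by simp_all
  note rec = partials_weight_Suc[OF assms(1) y(1), of j, unfolded y(2), OF Suc.prems(2)]
  note NL = weight_NL_tilings[OF assms(1) y(1), of j, unfolded y(2)]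
  consider "j = 0" | "j = Suc m" | i q where "j = Suc i" "m = Suc i + q"
  proof -
    have "j = 0 \<or> j = Suc m \<or> (\<exists>i q. j = Suc i \<and> m = Suc i + q)"
      using Suc.prems(2) by (cases j) (auto simp: le_less less_iff_Suc_add)
    then show ?thesis using that by blast
  qed
  then show ?case
  proof cases
    case 1
    then show ?thesis
      using IH[of 0] rec by (auto simp: lucastorial_Suc mult_ac)
  next
    case 2
    then show ?thesis
      using IH[of m] rec NL by (auto simp: lucastorial_Suc mult_ac)
  next
    case 3
    have sub: "Suc m - Suc i = Suc q" "m - i = Suc q" "m - Suc i = q" using 3 by auto
    have A: "partials_weight d n (Suc i) (Suc y) * (lucastorial d (Suc i) * lucastorial d q)
        = lucastorial d (Suc i + q)"
      using IH[of "Suc i"] 3 sub by simp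
    have B: "partials_weight d n i (Suc y) * (lucastorial d i * lucastorial d (Suc q))
        = lucastorial d (Suc i + q)"
      using IH[of i] 3 sub by simp
    have "partials_weight d n j y = lucas (Suc i * d + 1) * partials_weight d n (Suc i) (Suc y)
        + t_var * lucas (Suc q * d - 1) * partials_weight d n i (Suc y)"
      using rec NL 3 sub by simp
    then show ?thesis
      using lucastorial_recurrence[OF assms(1) A B] 3 sub by simp
  qed
qed

section \<open>Nonnegative coefficients and the Lucasnomial formula\<close>

lemma nat_polys_0: "0 \<in> nat_polys"
  by (simp add: nat_polys_def)

lemma nat_polys_add: "p \<in> nat_polys \<Longrightarrow> q \<in> nat_polys \<Longrightarrow> p + q \<in> nat_polys"
  by (simp add: nat_polys_def)

lemma Nats_sum: "(\<And>x. x \<in> A \<Longrightarrow> f x \<in> \<nat>) \<Longrightarrow> sum f A \<in> \<nat>"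
  by (induction A rule: infinite_finite_induct) auto

lemma nat_polys_mult: "p \<in> nat_polys \<Longrightarrow> q \<in> nat_polys \<Longrightarrow> p * q \<in> nat_polys"
  by (auto simp: nat_polys_def coeff_mult coeff_sum intro!: Nats_sum Nats_mult)

lemma nat_polys_power: "p \<in> nat_polys \<Longrightarrow> p ^ m \<in> nat_polys"
proof (induction m)
  case 0
  show ?case by (auto simp: nat_polys_def coeff_1)
qed (simp add: nat_polys_mult)

lemma wt_in_nat_polys: "wt P \<in> nat_polys"
proof -
  have "s_var \<in> nat_polys" "t_var \<in> nat_polys"
    by (auto simp: nat_polys_def s_var_def t_var_def coeff_pCons coeff_1 split: nat.splits)
  then show ?thesis
    by (simp add: wt_def nat_polys_mult nat_polys_power)
qed

lemma nat_polys_sum: "(\<And>x. x \<in> A \<Longrightarrow> f x \<in> nat_polys) \<Longrightarrow> sum f A \<in> nat_polys"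
  by (induction A rule: infinite_finite_induct) (auto simp: nat_polys_0 nat_polys_add)

theorem corollary5p2:
  fixes d n k :: nat
  assumes "d \<ge> 1" and "k \<le> n"
  shows "lucasnomial d n k = to_fract (\<Sum>P\<in>partial_tilings d n k. wt P)
         \<and> lucasnomial d n k \<in> to_fract ` nat_polys"
proof -
  let ?S = "\<Sum>P\<in>partial_tilings d n k. wt P"
  have "wt P = weight (snd P)" if "P \<in> partials d n k 0" for P
    using wt_eq_weight[of "snd P" "fst P"] partials_tiles(1)[of "fst P" "snd P"] that by simp
  then have "?S = partials_weight d n k 0"
    by (simp add: partials_weight_def partial_tilings_eq_partials)
  then have "?S * (lucastorial d k * lucastorial d (n - k)) = lucastorial d n"
    using partials_weight_lucastorial[OF assms(1), of 0 n n k] assms(2) by simp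
  then have "to_fract (lucastorial d n)
      = to_fract ?S * (to_fract (lucastorial d k) * to_fract (lucastorial d (n - k)))"
    by (metis to_fract_mult)
  then have "lucasnomial d n k = to_fract ?S"
    using lucastorial_nonzero[OF assms(1)] by (simp add: lucasnomial_def)
  moreover have "?S \<in> nat_polys"
    by (intro nat_polys_sum wt_in_nat_polys)
  ultimately show ?thesis by blast
qed

end
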